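(* (Correctness of the Knuth-like symbol-balanced construction.) Let $q\ge 2$ and $m\ge 1$ be integers, $k=qm$, and ${\bf u}\in({\cal A}_q)^k$. Set ${\bf u}_0={\bf u}$. For $v=1,2,\ldots,q-1$ successively, set $m_v=m_v({\bf u}_{v-1})$, $M_v=M_v({\bf u}_{v-1})$, and, for an index $i_v\in\{0,1,\ldots,k\}$, let ${\bf u}_v$ be obtained from ${\bf u}_{v-1}=(h_1,\ldots,h_k)$ by leaving every $h_i\notin{\cal A}_q^v$ unchanged and adding to every $h_i\in{\cal A}_q^v$ the value $$\left\{\begin{array}{ll}-q-1+2v-m_v & \mbox{if } i\le i_v,\\ -q-1+2v-M_v & \mbox{if } i>i_v,\end{array}\right.$$ the addition being done modulo $2q+2-2v$ such that the resulting symbol is in ${\cal A}_q^v$. Then in each round $v$ there exists at least one $i_v\in\{0,1,\ldots,k\}$ such that $S_{-q-1+2v}({\bf u}_v)=m$ (given that the indices in the previous rounds were chosen with this property), and with such choices the final sequence ${\bf x}={\bf u}_{q-1}$ is symbol-balanced. Moreover, let ${\bf p}$ be the image of $(i_1,\ldots,i_{q-1},m_1,\ldots,m_{q-1},M_1,\ldots,M_{q-1})$ under a fixed injective map from the set of such tuples (with $i_v\in\{0,\ldots,k\}$ and $m_v,M_v\in{\cal A}_q^v$) into the symbol-balanced sequences of some fixed length $p$ over ${\cal A}_q$. Then ${\bf c}=({\bf p},{\bf x})$ is symbol-balanced, and ${\bf u}$ is recovered from ${\bf c}$ as follows: retrieve the tuple from ${\bf p}$, set ${\bf x}_q={\bf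 x}$, and for $v=q-1,q-2,\ldots,1$ obtain ${\bf x}_v$ from ${\bf x}_{v+1}=(h_1,\ldots,h_k)$ by leaving every $h_i\notin{\cal A}_q^v$ unchanged and subtracting from every $h_i\in{\cal A}_q^v$ the value displayed above, modulo $2q+2-2v$ such that the resulting symbol is in ${\cal A}_q^v$; then ${\bf u}={\bf x}_1$.
   Context: For an integer $q\ge 2$, ${\cal A}_q=\{-q+1,-q+3,\ldots,q-3,q-1\}$. A sequence over ${\cal A}_q$ whose length is a positive multiple of $q$ is symbol-balanced (SB) if all $q$ symbols of ${\cal A}_q$ appear equally often in it. $S_j({\bf y})=|\{i:y_i=j\}|$ is the number of occurrences of $j$ in ${\bf y}$. For $v=1,\ldots,q-1$, ${\cal A}_q^v=\{-q-1+2v,-q+1+2v,\ldots,q-1\}$ is the set of the $q+1-v$ largest elements of ${\cal A}_q$, and for a sequence ${\bf y}$ over ${\cal A}_q$, $$M_v({\bf y})=\max\{j\in{\cal A}_q^v: S_j({\bf y})\ge S_i({\bf y})\ \forall i\in{\cal A}_q^v\},$$ $$m_v({\bf y})=\min\{j\in{\cal A}_q^v: S_j({\bf y})\le S_i({\bf y})\ \forall i\in{\cal A}_q^v\}.$$ $({\bf p},{\bf x})$ denotes concatenation. *)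

theory Defs
  imports Main "HOL-Number_Theory.Cong"
begin

definition alphabet :: "nat \<Rightarrow> int set" where
  "alphabet q = {- int q + 1 + 2 * int t | t. t < q}"

abbreviation low_symbol :: "nat \<Rightarrow> nat \<Rightarrow> int" where
  "low_symbol q v \<equiv> - int q - 1 + 2 * int v"

definition top_alphabet :: "nat \<Rightarrow> nat \<Rightarrow> int set" where
  "top_alphabet q v = {low_symbol q v + 2 * int t | t. t < q + 1 - v}"

abbreviation occ :: "int \<Rightarrow> int list \<Rightarrow> nat" where
  "occ j y \<equiv> count_list y j"

definition symbol_balanced :: "nat \<Rightarrow> int list \<Rightarrow> bool" where
  "symbol_balanced q y \<longleftrightarrow>
     set y \<subseteq> alphabet q \<and> length y > 0 \<and> q dvd length y \<and>
     (\<forall>a\<in>alphabet q. \<forall>b\<in>alphabet q. occ a y = occ b y)"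

definition most_frequent :: "nat \<Rightarrow> nat \<Rightarrow> int list \<Rightarrow> int" where
  "most_frequent q v y =
     Max {j \<in> top_alphabet q v. \<forall>i\<in>top_alphabet q v. occ j y \<ge> occ i y}"

definition least_frequent :: "nat \<Rightarrow> nat \<Rightarrow> int list \<Rightarrow> int" where
  "least_frequent q v y =
     Min {j \<in> top_alphabet q v. \<forall>i\<in>top_alphabet q v. occ j y \<le> occ i y}"

text \<open>The representative is unique whenever \<open>z\<close> has the parity of \<open>q - 1\<close>, see
  \<open>reduce_unique\<close>; this covers every use below.\<close>

definition reduce :: "nat \<Rightarrow> nat \<Rightarrow> int \<Rightarrow> int" where
  "reduce q v z =
     (THE a. a \<in> top_alphabet q v \<and> [a = z] (mod (2 * int q + 2 - 2 * int v)))"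

lemma reduce_unique:
  fixes z :: int
  assumes "v \<le> q" and "even (z - low_symbol q v)"
  shows "\<exists>!a. a \<in> top_alphabet q v \<and> [a = z] (mod (2 * int q + 2 - 2 * int v))"
proof -
  define l where "l = low_symbol q v"
  define n where "n = int q + 1 - int v"
  have n: "n > 0" "nat n = q + 1 - v" "2 * int q + 2 - 2 * int v = 2 * n"
    using assms(1) by (auto simp: n_def)
  obtain s where s: "z - l = 2 * s"
    using assms(2) unfolding l_def by (elim evenE)
  have key: "[l + 2 * t = z] (mod (2 * n)) \<longleftrightarrow> [t = s] (mod n)" for t :: int
  proof -
    have "l + 2 * t - z = 2 * (t - s)" using s by (simp add: algebra_simps)
    then show ?thesis by (simp add: cong_iff_dvd_diff del: right_diff_distrib_numeral)
  qed
  have top: "top_alphabet q v = {l + 2 * int t | t. t < nat n}"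
    by (simp add: top_alphabet_def l_def n(2))
  show ?thesis unfolding n(3)
  proof (rule ex1I[of _ "l + 2 * (s mod n)"])
    have "nat (s mod n) < nat n" "int (nat (s mod n)) = s mod n" using n(1) by simp_all
    then have "l + 2 * (s mod n) \<in> top_alphabet q v"
      unfolding top by (intro CollectI exI[of _ "nat (s mod n)"]) simp
    moreover have "[s mod n = s] (mod n)" by simp
    ultimately show "l + 2 * (s mod n) \<in> top_alphabet q v \<and> [l + 2 * (s mod n) = z] (mod (2 * n))"
      by (simp only: key)
  next
    fix a assume a: "a \<in> top_alphabet q v \<and> [a = z] (mod (2 * n))"
    then obtain t where t: "a = l + 2 * int t" "t < nat n" unfolding top by blast
    with a key have "[int t = s] (mod n)" by blast
    moreover have "int t mod n = int t" using t(2) by simp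
    ultimately show "a = l + 2 * (s mod n)" using t(1) by (simp add: cong_def)
  qed
qed

text \<open>List positions count from \<open>0\<close>, so entry \<open>n\<close> is the symbol with index \<open>n + 1\<close>.\<close>

definition shift :: "nat \<Rightarrow> nat \<Rightarrow> nat \<Rightarrow> int \<Rightarrow> int \<Rightarrow> nat \<Rightarrow> int" where
  "shift q v i a b n = low_symbol q v - (if n + 1 \<le> i then a else b)"

definition add_round :: "nat \<Rightarrow> nat \<Rightarrow> nat \<Rightarrow> int \<Rightarrow> int \<Rightarrow> int list \<Rightarrow> int list" where
  "add_round q v i a b y =
     map (\<lambda>n. if y ! n \<in> top_alphabet q v then reduce q v (y ! n + shift q v i a b n) else y ! n)
       [0..<length y]"

definition sub_round :: "nat \<Rightarrow> nat \<Rightarrow> nat \<Rightarrow> int \<Rightarrow> int \<Rightarrow> int list \<Rightarrow> int list" where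
  "sub_round q v i a b y =
     map (\<lambda>n. if y ! n \<in> top_alphabet q v then reduce q v (y ! n - shift q v i a b n) else y ! n)
       [0..<length y]"

text \<open>\<open>enc q u i v\<close> is the sequence after round \<open>v\<close>; it depends on \<open>i 1, \<dots>, i v\<close> only.\<close>

primrec enc :: "nat \<Rightarrow> int list \<Rightarrow> (nat \<Rightarrow> nat) \<Rightarrow> nat \<Rightarrow> int list" where
  "enc q u i 0 = u"
| "enc q u i (Suc v) =
     add_round q (Suc v) (i (Suc v))
       (least_frequent q (Suc v) (enc q u i v)) (most_frequent q (Suc v) (enc q u i v))
       (enc q u i v)"

type_synonym side_info = "nat list \<times> int list \<times> int list"

definition side_infos :: "nat \<Rightarrow> nat \<Rightarrow> side_info set" where
  "side_infos q k =
     {(is, as, bs). length is = q - 1 \<and> length as = q - 1 \<and> length bs = q - 1 \<and>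
        (\<forall>v\<in>{1..q-1}. is ! (v - 1) \<le> k \<and>
           as ! (v - 1) \<in> top_alphabet q v \<and> bs ! (v - 1) \<in> top_alphabet q v)}"

definition enc_info :: "nat \<Rightarrow> int list \<Rightarrow> (nat \<Rightarrow> nat) \<Rightarrow> side_info" where
  "enc_info q u i =
     (map i [1..<q],
      map (\<lambda>v. least_frequent q v (enc q u i (v - 1))) [1..<q],
      map (\<lambda>v. most_frequent q v (enc q u i (v - 1))) [1..<q])"

text \<open>\<open>foldr\<close> applies the rounds in the order \<open>v = q - 1, \<dots>, 1\<close>.\<close>

definition dec_rounds :: "nat \<Rightarrow> side_info \<Rightarrow> int list \<Rightarrow> int list" where
  "dec_rounds q = (\<lambda>(is, as, bs) x.
     foldr (\<lambda>v. sub_round q v (is ! (v - 1)) (as ! (v - 1)) (bs ! (v - 1))) [1..<q] x)"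

definition decode :: "nat \<Rightarrow> nat \<Rightarrow> nat \<Rightarrow> (side_info \<Rightarrow> int list) \<Rightarrow> int list \<Rightarrow> int list" where
  "decode q k p \<phi> c = dec_rounds q (inv_into (side_infos q k) \<phi> (take p c)) (drop p c)"

definition good_index :: "nat \<Rightarrow> nat \<Rightarrow> int list \<Rightarrow> (nat \<Rightarrow> nat) \<Rightarrow> nat \<Rightarrow> bool" where
  "good_index q m u i v \<longleftrightarrow> i v \<le> q * m \<and> occ (low_symbol q v) (enc q u i v) = m"

end

(* With m_v and M_v as shifts, a symbol becomes the lowest one of A_q^v exactly if it equals m_v
   (positions up to i_v) or M_v (positions after i_v). Hence S_{-q-1+2v}(u_v) moves in steps of at most 1
   from S_{M_v}(u_{v-1}) at i_v = 0 to S_{m_v}(u_{v-1}) at i_v = k, and these two counts enclose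
   the average m, because the lower symbols already occur m times each. Later rounds do not touch
   a symbol that has been balanced, and each round is a bijection on every position. *)

theory Submission
  imports Defs
begin

section \<open>The nested alphabets, each symbol indexed by the round in which it is the lowest
  one\<close>

lemma top_alphabet_eq_image:
  assumes "v \<le> q + 1"
  shows "top_alphabet q v = (\<lambda>w. low_symbol q w) ` {v..q}"
proof (intro equalityI subsetI)
  fix z assume "z \<in> top_alphabet q v"
  then obtain t where "z = low_symbol q (v + t)" "v + t \<in> {v..q}"
    by (auto simp: top_alphabet_def)
  then show "z \<in> (\<lambda>w. low_symbol q w) ` {v..q}"
    by blast
next
  fix z assume "z \<in> (\<lambda>w. low_symbol q w) ` {v..q}"
  then obtain w where "z = low_symbol q w" "v \<le> w" "w \<le> q"
    by auto
  then have "z = low_symbol q v + 2 * int (w - v)" "w - v < q + 1 - v"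
    by auto
  then show "z \<in> top_alphabet q v"
    unfolding top_alphabet_def by blast
qed

lemma alphabet_eq_image: "alphabet q = (\<lambda>w. low_symbol q w) ` {1..q}"
proof -
  have "alphabet q = top_alphabet q 1"
    by (simp add: alphabet_def top_alphabet_def)
  then show ?thesis
    by (simp only: top_alphabet_eq_image[of 1 q])
qed

lemma inj_low_symbol: "inj_on (\<lambda>w. low_symbol q w) A"
  by (auto simp: inj_on_def)

lemma finite_top_alphabet: "finite (top_alphabet q v)"
  by (simp add: top_alphabet_def)

lemma low_symbol_in_top_alphabet: "v \<le> q \<Longrightarrow> low_symbol q v \<in> top_alphabet q v"
  by (auto simp: top_alphabet_eq_image)

text \<open>This is why a symbol balanced in round \<open>w\<close> is safe afterwards: every later
  round acts only on an alphabet that lacks it.\<close>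

lemma low_symbol_notin_top_alphabet:
  assumes "w < v" "v \<le> q"
  shows "low_symbol q w \<notin> top_alphabet q v"
  using assms by (auto simp: top_alphabet_eq_image)

lemma top_alphabet_subset_alphabet: "1 \<le> v \<Longrightarrow> v \<le> q \<Longrightarrow> top_alphabet q v \<subseteq> alphabet q"
  unfolding alphabet_eq_image by (auto simp: top_alphabet_eq_image)

lemma even_diff_low_symbol: "z \<in> top_alphabet q v \<Longrightarrow> even (z - low_symbol q v)"
  by (auto simp: top_alphabet_def)

section \<open>Modular reduction and the action of a round on a single symbol\<close>

lemma
  assumes "v \<le> q" "even (z - low_symbol q v)"
  shows reduce_in_top_alphabet: "reduce q v z \<in> top_alphabet q v"
    and reduce_cong: "[reduce q v z = z] (mod (2 * int q + 2 - 2 * int v))"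
  using theI'[OF reduce_unique[OF assms]] by (simp_all add: reduce_def)

text \<open>The parity condition on \<open>z\<close> comes for free: the modulus is even, so the
  congruence passes the parity of \<open>a\<close> on to \<open>z\<close>, and
  \<open>reduce_unique\<close> applies.\<close>

lemma reduce_eqI:
  assumes "v \<le> q" "a \<in> top_alphabet q v" "[a = z] (mod (2 * int q + 2 - 2 * int v))"
  shows "reduce q v z = a"
proof -
  have "even (2 * int q + 2 - 2 * int v)"
    by simp
  then have "even (a - z)"
    using assms(3) by (meson cong_iff_dvd_diff dvd_trans)
  then have "even (z - low_symbol q v)"
    using even_diff_low_symbol[OF assms(2)] by simp
  then show ?thesis
    unfolding reduce_def using the1_equality[OF reduce_unique] assms by blast
qed

text \<open>The shift \<open>s\<close> is a parameter free of positions and of direction, so that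
  both halves of a sequence, and both encoding (\<open>s\<close>) and decoding (\<open>- s\<close>),
  are instances of one operation.\<close>

definition move :: "nat \<Rightarrow> nat \<Rightarrow> int \<Rightarrow> int \<Rightarrow> int" where
  "move q v s z = (if z \<in> top_alphabet q v then reduce q v (z + s) else z)"

lemma move_in_top_alphabet:
  assumes "v \<le> q" "even s" "z \<in> top_alphabet q v"
  shows "move q v s z \<in> top_alphabet q v"
  using assms even_diff_low_symbol[OF assms(3)]
  by (simp add: move_def reduce_in_top_alphabet)

text \<open>Inside the alphabet, undoing the shift yields a number congruent to \<open>z\<close>; as
  \<open>z\<close> is itself an admissible representative, uniqueness forces the result to be
  \<open>z\<close>.\<close>

lemma move_uminus_move:
  assumes "v \<le> q" "even s"
  shows "move q v (- s) (move q v s z) = z"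
proof (cases "z \<in> top_alphabet q v")
  case True
  have "even (z + s - low_symbol q v)"
    using even_diff_low_symbol[OF True] assms(2) by simp
  from cong_diff[OF reduce_cong[OF assms(1) this] cong_refl, of s]
  have "[z = reduce q v (z + s) + - s] (mod (2 * int q + 2 - 2 * int v))"
    by (simp add: cong_sym)
  then show ?thesis
    using move_in_top_alphabet[OF assms True] True reduce_eqI[OF assms(1) True]
    by (simp add: move_def)
qed (simp add: move_def)

lemma inj_move: "v \<le> q \<Longrightarrow> even s \<Longrightarrow> inj (move q v s)"
  by (metis injI move_uminus_move)

text \<open>Combined with \<open>inj_move\<close>, this makes \<open>d\<close> the only symbol sent
  to the lowest one, so counting lowest symbols after a round amounts to counting \<open>d\<close>
  before it.\<close>

lemma move_to_low_symbol:
  assumes "v \<le> q" "d \<in> top_alphabet q v"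
  shows "move q v (low_symbol q v - d) d = low_symbol q v"
proof -
  have "d + (low_symbol q v - d) = low_symbol q v"
    by simp
  then show ?thesis
    using reduce_eqI[OF assms(1) low_symbol_in_top_alphabet[OF assms(1)] cong_refl] assms(2)
    by (simp only: move_def if_True)
qed

section \<open>One round on a whole sequence\<close>

lemma count_list_map_inj:
  assumes "inj f"
  shows "count_list (map f xs) (f x) = count_list xs x"
  by (induction xs) (auto dest: injD[OF assms])

text \<open>Positions count from 0, so the test \<open>n + 1 \<le> i\<close> selects exactly the
  first \<open>i\<close> entries. A round thus becomes two plain maps on a prefix and a
  suffix.\<close>

lemma map_upt_split:
  "map (\<lambda>n. if n + 1 \<le> i then f (y ! n) else g (y ! n)) [0..<length y]
     = map f (take i y) @ map g (drop i y)"
  by (rule nth_equalityI) (auto simp: nth_append)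

lemma add_round_eq:
  "add_round q v i a b y =
     map (move q v (low_symbol q v - a)) (take i y) @ map (move q v (low_symbol q v - b)) (drop i y)"
  unfolding add_round_def map_upt_split[symmetric]
  by (intro map_cong refl) (simp add: move_def shift_def)

lemma sub_round_eq:
  "sub_round q v i a b y =
     map (move q v (- (low_symbol q v - a))) (take i y)
     @ map (move q v (- (low_symbol q v - b))) (drop i y)"
  unfolding sub_round_def map_upt_split[symmetric]
  by (intro map_cong refl) (simp add: move_def shift_def algebra_simps)

lemma length_add_round [simp]: "length (add_round q v i a b y) = length y"
  by (simp add: add_round_def)

context
  fixes q v :: nat and a b :: int
  assumes v: "1 \<le> v" "v \<le> q"
    and a: "a \<in> top_alphabet q v" and b: "b \<in> top_alphabet q v"
begin

lemma even_shifts: "even (low_symbol q v - a)" "even (low_symbol q v - b)"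
  using even_diff_low_symbol[OF a] even_diff_low_symbol[OF b] by simp_all

lemma sub_round_add_round: "sub_round q v i a b (add_round q v i a b y) = y"
proof -
  have "map (move q v (- s)) (map (move q v s) xs) = xs" if "even s" for s xs
    using move_uminus_move[OF v(2) that] by (simp add: map_idI)
  note inv = this[OF even_shifts(1)] this[OF even_shifts(2)]
  \<comment> \<open>Mapping preserves lengths, so the split falls at the same place before and after
    the round; if \<open>i\<close> exceeds the length, the suffix is empty.\<close>
  have "take i (add_round q v i a b y) = map (move q v (low_symbol q v - a)) (take i y)"
    "drop i (add_round q v i a b y) = map (move q v (low_symbol q v - b)) (drop i y)"
    by (auto simp: add_round_eq min_def)
  then show ?thesis
    unfolding sub_round_eq by (simp only: inv append_take_drop_id)
qed

lemma set_add_round: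
  assumes "set y \<subseteq> alphabet q"
  shows "set (add_round q v i a b y) \<subseteq> alphabet q"
proof -
  have "move q v s z \<in> alphabet q" if "even s" "z \<in> alphabet q" for s z
    using move_in_top_alphabet[OF v(2) that(1), of z] that(2) top_alphabet_subset_alphabet[OF v]
    by (cases "z \<in> top_alphabet q v") (auto simp: move_def)
  then show ?thesis
    unfolding add_round_eq set_append set_map
    using even_shifts assms set_take_subset[of i y] set_drop_subset[of i y] by blast
qed

lemma occ_low_add_round:
  "occ (low_symbol q v) (add_round q v i a b y) = occ a (take i y) + occ b (drop i y)"
  using count_list_map_inj[OF inj_move[OF v(2) even_shifts(1)], of "take i y" a]
    count_list_map_inj[OF inj_move[OF v(2) even_shifts(2)], of "drop i y" b]
    move_to_low_symbol[OF v(2) a] move_to_low_symbol[OF v(2) b]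
  by (simp only: add_round_eq count_list_append)

text \<open>The symbol \<open>j\<close> is fixed by \<open>move\<close>, and by injectivity no other
  symbol can turn into it.\<close>

lemma occ_add_round_notin:
  assumes "j \<notin> top_alphabet q v"
  shows "occ j (add_round q v i a b y) = occ j y"
proof -
  have "occ j (map (move q v s) xs) = occ j xs" if "even s" for s xs
    using count_list_map_inj[OF inj_move[OF v(2) that], of xs j] assms by (simp add: move_def)
  with even_shifts show ?thesis
    unfolding add_round_eq count_list_append by (simp only: flip: count_list_append) simp
qed

text \<open>A discrete intermediate value argument in the split index, for arbitrary
  \<open>a\<close> and \<open>b\<close> whose counts enclose \<open>m\<close>.\<close>

lemma ex_split_index:
  assumes "occ a y \<le> m" "m \<le> occ b y"
  shows "\<exists>i\<le>length y. occ (low_symbol q v) (add_round q v i a b y) = m"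
proof -
  \<comment> \<open>The count starts at \<open>occ b y\<close> and ends at \<open>occ a y\<close>,
    hence from above \<open>m\<close> to below it; the sign is flipped because
    \<open>nat0_intermed_int_val\<close> expects the lower value at 0.\<close>
  define f where "f i = - int (occ a (take i y) + occ b (drop i y))" for i
  have step: "\<bar>f (i + 1) - f i\<bar> \<le> 1" if "i < length y" for i
  proof -
    \<comment> \<open>Advancing the split moves the single entry \<open>y ! i\<close> from the part
      where \<open>b\<close> is counted to the part where \<open>a\<close> is counted.\<close>
    have "take (i + 1) y = take i y @ [y ! i]" "drop i y = y ! i # drop (i + 1) y"
      using that by (simp_all add: take_Suc_conv_app_nth Cons_nth_drop_Suc)
    then show ?thesis
      by (simp add: f_def)
  qed
  have "f 0 \<le> - int m" "- int m \<le> f (length y)"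
    using assms by (simp_all add: f_def)
  with nat0_intermed_int_val[of "length y" f "- int m"] step
  obtain i where "i \<le> length y" "f i = - int m"
    by auto
  then show ?thesis
    unfolding occ_low_add_round f_def by (intro exI[of _ i]) linarith
qed

end

section \<open>Extremal symbols and the average count\<close>

lemma
  assumes "v \<le> q"
  shows least_frequent_in: "least_frequent q v y \<in> top_alphabet q v"
    and least_frequent_le: "j \<in> top_alphabet q v \<Longrightarrow> occ (least_frequent q v y) y \<le> occ j y"
proof -
  let ?S = "{j \<in> top_alphabet q v. \<forall>i\<in>top_alphabet q v. occ j y \<le> occ i y}"
  let ?C = "(\<lambda>j. occ j y) ` top_alphabet q v"
  have C: "finite ?C" "?C \<noteq> {}"
    using low_symbol_in_top_alphabet[OF assms] by (auto simp: finite_top_alphabet)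
  \<comment> \<open>A symbol attaining the smallest count shows that \<open>?S\<close> is nonempty,
    so its \<open>Min\<close> is a member of it.\<close>
  obtain j0 where "j0 \<in> top_alphabet q v" "occ j0 y = Min ?C"
    using Min_in[OF C] by (metis (no_types, lifting) imageE)
  then have "j0 \<in> ?S"
    using C(1) by simp
  then have "least_frequent q v y \<in> ?S"
    unfolding least_frequent_def by (intro Min_in) (auto simp: finite_top_alphabet)
  then show "least_frequent q v y \<in> top_alphabet q v"
    "j \<in> top_alphabet q v \<Longrightarrow> occ (least_frequent q v y) y \<le> occ j y"
    by blast+
qed

lemma
  assumes "v \<le> q"
  shows most_frequent_in: "most_frequent q v y \<in> top_alphabet q v"
    and most_frequent_ge: "j \<in> top_alphabet q v \<Longrightarrow> occ j y \<le> occ (most_frequent q v y) y"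
proof -
  let ?S = "{j \<in> top_alphabet q v. \<forall>i\<in>top_alphabet q v. occ j y \<ge> occ i y}"
  let ?C = "(\<lambda>j. occ j y) ` top_alphabet q v"
  have C: "finite ?C" "?C \<noteq> {}"
    using low_symbol_in_top_alphabet[OF assms] by (auto simp: finite_top_alphabet)
  obtain j0 where "j0 \<in> top_alphabet q v" "occ j0 y = Max ?C"
    using Max_in[OF C] by (metis (no_types, lifting) imageE)
  then have "j0 \<in> ?S"
    using C(1) by simp
  then have "most_frequent q v y \<in> ?S"
    unfolding most_frequent_def by (intro Max_in) (auto simp: finite_top_alphabet)
  then show "most_frequent q v y \<in> top_alphabet q v"
    "j \<in> top_alphabet q v \<Longrightarrow> occ j y \<le> occ (most_frequent q v y) y"
    by blast+
qed

text \<open>Of the \<open>q * m\<close> entries, the \<open>v - 1\<close> lower symbols take up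
  \<open>m\<close> each, which leaves \<open>(q + 1 - v) * m\<close> for the top alphabet: an
  average of \<open>m\<close> per symbol.\<close>

lemma sum_occ_top_alphabet:
  assumes "1 \<le> v" "v \<le> q" "set y \<subseteq> alphabet q" "length y = q * m"
    and low: "\<And>w. w \<in> {1..<v} \<Longrightarrow> occ (low_symbol q w) y = m"
  shows "(\<Sum>j\<in>top_alphabet q v. occ j y) = card (top_alphabet q v) * m"
proof -
  have top: "(\<Sum>j\<in>top_alphabet q v. occ j y) = (\<Sum>w\<in>{v..q}. occ (low_symbol q w) y)"
    using assms(2) by (simp add: top_alphabet_eq_image sum.reindex inj_low_symbol)
  have "q * m = (\<Sum>w\<in>{1..q}. occ (low_symbol q w) y)"
    using sum_count_set[of y "alphabet q"] assms(3,4)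
    unfolding alphabet_eq_image by (simp add: sum.reindex inj_low_symbol)
  also have "{1..q} = {1..<v} \<union> {v..q}"
    using assms(1,2) by auto
  also have "(\<Sum>w\<in>{1..<v} \<union> {v..q}. occ (low_symbol q w) y)
      = (\<Sum>w\<in>{1..<v}. occ (low_symbol q w) y) + (\<Sum>w\<in>{v..q}. occ (low_symbol q w) y)"
    by (rule sum.union_disjoint) auto
  also have "(\<Sum>w\<in>{1..<v}. occ (low_symbol q w) y) = (v - 1) * m"
    using low by simp
  finally have "q * m = (v - 1) * m + (\<Sum>j\<in>top_alphabet q v. occ j y)"
    by (simp only: top)
  moreover have "q * m = (v - 1) * m + (q + 1 - v) * m"
    using assms(1,2) by (simp flip: add_mult_distrib)
  moreover have "card (top_alphabet q v) = q + 1 - v"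
    using assms(2) by (simp add: top_alphabet_eq_image card_image inj_low_symbol)
  ultimately show ?thesis
    by simp
qed

text \<open>A minimum is at most the average and a maximum at least the average, which is
  \<open>m\<close>.\<close>

lemma frequent_bounds:
  assumes "1 \<le> v" "v \<le> q" "set y \<subseteq> alphabet q" "length y = q * m"
    and "\<And>w. w \<in> {1..<v} \<Longrightarrow> occ (low_symbol q w) y = m"
  shows "occ (least_frequent q v y) y \<le> m" "m \<le> occ (most_frequent q v y) y"
proof -
  note sum = sum_occ_top_alphabet[OF assms]
  have pos: "card (top_alphabet q v) > 0"
    using low_symbol_in_top_alphabet[OF assms(2)] by (auto simp: card_gt_0_iff finite_top_alphabet)
  have "card (top_alphabet q v) * occ (least_frequent q v y) y \<le> (\<Sum>j\<in>top_alphabet q v. occ j y)"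
    using sum_bounded_below[of "top_alphabet q v" "occ (least_frequent q v y) y" "\<lambda>j. occ j y"]
      least_frequent_le[OF assms(2)] by simp
  then show "occ (least_frequent q v y) y \<le> m"
    using sum pos by simp
  have "(\<Sum>j\<in>top_alphabet q v. occ j y) \<le> card (top_alphabet q v) * occ (most_frequent q v y) y"
    using sum_bounded_above[of "top_alphabet q v" "\<lambda>j. occ j y" "occ (most_frequent q v y) y"]
      most_frequent_ge[OF assms(2)] by simp
  then show "m \<le> occ (most_frequent q v y) y"
    using sum pos by simp
qed

section \<open>The encoder over all rounds\<close>

lemma length_enc [simp]: "length (enc q u i v) = length u"
  by (induction v) simp_all

lemma set_enc:
  assumes "set u \<subseteq> alphabet q" "v \<le> q"
  shows "set (enc q u i v) \<subseteq> alphabet q"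
  using assms(2)
proof (induction v)
  case (Suc v)
  then show ?case
    by (simp add: set_add_round least_frequent_in most_frequent_in)
qed (simp add: assms(1))

text \<open>Allows the index of a round to be chosen anew without disturbing the rounds before
  it.\<close>

lemma enc_cong:
  assumes "\<And>w. w \<in> {1..v} \<Longrightarrow> i w = j w"
  shows "enc q u i v = enc q u j v"
  using assms by (induction v) auto

lemma occ_low_enc:
  assumes "v \<le> q" "w \<in> {1..v}"
  shows "occ (low_symbol q w) (enc q u i v) = occ (low_symbol q w) (enc q u i w)"
  using assms
proof (induction v)
  case (Suc v)
  show ?case
  proof (cases "w = Suc v")
    case False
    with Suc have "low_symbol q w \<notin> top_alphabet q (Suc v)"
      by (intro low_symbol_notin_top_alphabet) auto
    then have "occ (low_symbol q w) (enc q u i (Suc v)) = occ (low_symbol q w) (enc q u i v)"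
      unfolding enc.simps using Suc.prems(1)
      by (intro occ_add_round_notin least_frequent_in most_frequent_in) auto
    also have "\<dots> = occ (low_symbol q w) (enc q u i w)"
      using False Suc by auto
    finally show ?thesis .
  qed simp
qed simp

lemma ex_good_index:
  assumes "length u = q * m" "set u \<subseteq> alphabet q" "v \<in> {1..q-1}"
    and good: "\<forall>w\<in>{1..<v}. good_index q m u i w"
  shows "\<exists>j. good_index q m u (i(v := j)) v"
proof -
  obtain v' where v': "v = Suc v'" "Suc v' \<le> q"
    using assms(3) by (cases v) auto
  \<comment> \<open>The input of round \<open>v\<close>; it is fixed before the index
    \<open>j\<close> of that round is chosen.\<close>
  define y where "y = enc q u i v'"
  have y: "set y \<subseteq> alphabet q" "length y = q * m"
    using assms(1,2) v' by (simp_all add: y_def set_enc)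
  have "occ (low_symbol q w) y = m" if "w \<in> {1..<v}" for w
    unfolding y_def using occ_low_enc[of v' q w u i] good that v' by (auto simp: good_index_def)
  then obtain j where j: "j \<le> length y"
    "occ (low_symbol q v) (add_round q v j (least_frequent q v y) (most_frequent q v y) y) = m"
    using ex_split_index[OF _ _ least_frequent_in most_frequent_in frequent_bounds] v' y
    by (metis le_add1 plus_1_eq_Suc)
  have "enc q u (i(v := j)) v' = y"
    unfolding y_def by (rule enc_cong) (auto simp: v'(1))
  then have "good_index q m u (i(v := j)) v"
    using j y(2) by (simp add: good_index_def v'(1))
  then show ?thesis ..
qed

lemma symbol_balanced_enc:
  assumes "q \<ge> 1" "m \<ge> 1" "length u = q * m" "set u \<subseteq> alphabet q"
    and good: "\<forall>v\<in>{1..q-1}. good_index q m u i v"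
  shows "symbol_balanced q (enc q u i (q - 1))"
proof -
  let ?x = "enc q u i (q - 1)"
  have x: "set ?x \<subseteq> alphabet q" "length ?x = q * m"
    using assms(3,4) by (simp_all add: set_enc)
  have low: "occ (low_symbol q w) ?x = m" if "w \<in> {1..<q}" for w
    using occ_low_enc[of "q - 1" q w u i] good that by (auto simp: good_index_def)
  \<comment> \<open>Only \<open>q - 1\<close> rounds are performed. The highest symbol is left alone
    in the last alphabet, so the counting identity for \<open>v = q\<close> gives its count.\<close>
  have "top_alphabet q q = {low_symbol q q}"
    by (simp add: top_alphabet_eq_image)
  then have "occ (low_symbol q q) ?x = m"
    using sum_occ_top_alphabet[OF assms(1) order_refl x low] by simp
  then have "occ (low_symbol q w) ?x = m" if "w \<in> {1..q}" for w
    using low[of w] that by (cases "w = q") auto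
  then have "occ a ?x = m" if "a \<in> alphabet q" for a
    using that unfolding alphabet_eq_image by blast
  then show ?thesis
    using x assms(1,2) by (simp add: symbol_balanced_def)
qed

section \<open>Side information and decoding\<close>

lemma enc_info_in_side_infos:
  assumes "\<forall>v\<in>{1..q-1}. i v \<le> k"
  shows "enc_info q u i \<in> side_infos q k"
  using assms by (auto simp: enc_info_def side_infos_def least_frequent_in most_frequent_in)

lemma dec_rounds_enc:
  "dec_rounds q (enc_info q u i) (enc q u i (q - 1)) = u"
proof -
  define F where "F v = sub_round q v (i v) (least_frequent q v (enc q u i (v - 1)))
    (most_frequent q v (enc q u i (v - 1)))" for v
  \<comment> \<open>Stated for every number \<open>v\<close> of rounds so that induction works:
    \<open>foldr\<close> applies the last list element first, and this undoes the most recent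
    round.\<close>
  have F: "foldr F [1..<Suc v] (enc q u i v) = u" if "v \<le> q" for v
    using that
  proof (induction v)
    case (Suc v)
    have "F (Suc v) (enc q u i (Suc v)) = enc q u i v"
      unfolding F_def using Suc.prems
      by (simp add: sub_round_add_round least_frequent_in most_frequent_in)
    with Suc show ?case
      by simp
  qed simp
  have "dec_rounds q (enc_info q u i) (enc q u i (q - 1)) = foldr F [1..<q] (enc q u i (q - 1))"
    \<comment> \<open>The lists in the side information count from 0, so entry \<open>v - 1\<close>
      belongs to round \<open>v\<close> and equals the parameter in \<open>F v\<close>.\<close>
    unfolding dec_rounds_def enc_info_def prod.case by (rule foldr_cong) (auto simp: F_def)
  also have "\<dots> = u"
    using F[of "q - 1"] by (cases q) simp_all
  finally show ?thesis .
qed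

lemma symbol_balanced_append:
  "symbol_balanced q x \<Longrightarrow> symbol_balanced q y \<Longrightarrow> symbol_balanced q (x @ y)"
  unfolding symbol_balanced_def set_append length_append count_list_append
  by (metis Un_least add_gr_0 dvd_add)

theorem mainTheorem11:
  fixes q m k :: nat and u :: "int list"
  assumes "q \<ge> 2" and "m \<ge> 1" and "k = q * m"
    and "length u = k" and "set u \<subseteq> alphabet q"
  shows "(\<forall>i. \<forall>v\<in>{1..q-1}. (\<forall>w\<in>{1..<v}. good_index q m u i w) \<longrightarrow>
            (\<exists>j. good_index q m u (i(v := j)) v))
     \<and> (\<forall>i. (\<forall>v\<in>{1..q-1}. good_index q m u i v) \<longrightarrow>
            symbol_balanced q (enc q u i (q - 1)) \<and>
            enc_info q u i \<in> side_infos q k \<and>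
            (\<forall>(p::nat) (\<phi> :: side_info \<Rightarrow> int list).
               inj_on \<phi> (side_infos q k) \<and>
               (\<forall>t\<in>side_infos q k. symbol_balanced q (\<phi> t) \<and> length (\<phi> t) = p) \<longrightarrow>
               (let c = \<phi> (enc_info q u i) @ enc q u i (q - 1)
                in symbol_balanced q c \<and> decode q k p \<phi> c = u)))"
proof (intro conjI allI impI ballI)
  fix i v
  assume "v \<in> {1..q-1}" "\<forall>w\<in>{1..<v}. good_index q m u i w"
  then show "\<exists>j. good_index q m u (i(v := j)) v"
    using ex_good_index assms by blast
next
  fix i
  assume good: "\<forall>v\<in>{1..q-1}. good_index q m u i v"
  show balanced: "symbol_balanced q (enc q u i (q - 1))"
    using symbol_balanced_enc[OF _ assms(2) _ assms(5) good] assms(1,3,4) by simp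
  show info: "enc_info q u i \<in> side_infos q k"
    using good assms(3) by (intro enc_info_in_side_infos) (simp add: good_index_def)
  fix p :: nat and \<phi> :: "side_info \<Rightarrow> int list"
  assume \<phi>: "inj_on \<phi> (side_infos q k) \<and>
    (\<forall>t\<in>side_infos q k. symbol_balanced q (\<phi> t) \<and> length (\<phi> t) = p)"
  \<comment> \<open>All images have the same length \<open>p\<close>, so cutting at \<open>p\<close>
    separates the two parts; injectivity on \<open>side_infos q k\<close> then returns the
    tuple.\<close>
  have "decode q k p \<phi> (\<phi> (enc_info q u i) @ enc q u i (q - 1)) = u"
    using \<phi> info dec_rounds_enc[of q u i] by (simp add: decode_def)
  then show "let c = \<phi> (enc_info q u i) @ enc q u i (q - 1)
      in symbol_balanced q c \<and> decode q k p \<phi> c = u"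
    using \<phi> info balanced by (simp add: Let_def symbol_balanced_append)
qed

end
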